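(* Let $N,k\ge 1$ be integers and let $\alpha_1,\dots,\alpha_k\in\mathbb{C}$. Then $$\mathbb{E}_N\left[\frac{1}{N}\sum_{n=1}^N Z(\theta_n+\alpha_1)\cdots Z(\theta_n+\alpha_k)\right]=\frac{1}{N}\prod_{r=1}^k\left(1-e^{-i\alpha_r}\right)\,h_{N-1}\left(e^{-i\alpha_1},\dots,e^{-i\alpha_k},1,1\right),$$ where $h_{N-1}$ is the complete homogeneous symmetric polynomial of degree $N-1$, here in $k+2$ variables. Moreover, if $e^{-i\alpha_1},\dots,e^{-i\alpha_k}$ are pairwise distinct and all different from $1$, this common value also equals $$\frac{1}{N}\left(\sum_{r=1}^{k}\frac{e^{-i(N+k)\alpha_r}}{1-e^{-i\alpha_r}}\prod_{\substack{j=1\\ j\neq r}}^{k}\frac{1-e^{-i\alpha_j}}{e^{-i\alpha_r}-e^{-i\alpha_j}}+N+k-\sum_{\ell=1}^k\frac{1}{1-e^{-i\alpha_\ell}}\right).$$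
   Context: For an $N\times N$ unitary matrix with eigenvalues $e^{i\theta_1},\dots,e^{i\theta_N}$, the characteristic polynomial is $Z(\theta)=\prod_{m=1}^N\left(1-e^{i\theta_m}e^{-i\theta}\right)$, viewed as an entire function of $\theta\in\mathbb{C}$. $\mathbb{E}_N$ denotes expectation over Haar measure on the $N\times N$ unitary group; in terms of the eigenphases $(\theta_1,\dots,\theta_N)\in[-\pi,\pi)^N$ this is integration against the Weyl density $\frac{1}{N!(2\pi)^N}\prod_{1\le j<\ell\le N}|e^{i\theta_j}-e^{i\theta_\ell}|^2\,d\theta_1\cdots d\theta_N$. The complete homogeneous symmetric polynomial of degree $m$ in $q$ variables is $h_m(x_1,\dots,x_q)=\sum_{n_1,\dots,n_q\ge 0,\ n_1+\cdots+n_q=m}x_1^{n_1}\cdots x_q^{n_q}$. *)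

theory Defs
  imports "HOL-Analysis.Analysis"
begin

definition char_poly_Z :: "nat \<Rightarrow> (nat \<Rightarrow> real) \<Rightarrow> complex \<Rightarrow> complex" where
  "char_poly_Z N \<theta> z = (\<Prod>m = 1..N. 1 - exp (\<i> * of_real (\<theta> m)) * exp (- \<i> * z))"

definition weyl_density :: "nat \<Rightarrow> (nat \<Rightarrow> real) \<Rightarrow> real" where
  "weyl_density N \<theta> =
     1 / (fact N * (2 * pi) ^ N) *
     (\<Prod>(j, l) \<in> {(j, l). 1 \<le> j \<and> j < l \<and> l \<le> N}. (cmod (cis (\<theta> j) - cis (\<theta> l)))\<^sup>2)"

(* Law of the eigenphases of a Haar-distributed N x N unitary matrix, given by the Weyl
   density with respect to Lebesgue measure on [-pi, pi)^N.  The exchangeable eigenphases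
   are indexed by 1..N; a point of the space is a function on {1..N}. *)
definition haar_eigenphases :: "nat \<Rightarrow> (nat \<Rightarrow> real) measure" where
  "haar_eigenphases N =
     density (\<Pi>\<^sub>M j \<in> {1..N}. restrict_space lborel {- pi..<pi})
       (\<lambda>\<theta>. ennreal (weyl_density N \<theta>))"

definition expectation_U :: "nat \<Rightarrow> ((nat \<Rightarrow> real) \<Rightarrow> complex) \<Rightarrow> complex" where
  "expectation_U N F = integral\<^sup>L (haar_eigenphases N) F"

(* The variables are the entries of the list xs (so q = length xs), and ns lists the exponents. *)
definition complete_homogeneous :: "nat \<Rightarrow> 'a::comm_semiring_1 list \<Rightarrow> 'a" where
  "complete_homogeneous m xs =
     (\<Sum>ns \<in> {ns :: nat list. length ns = length xs \<and> sum_list ns = m}.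
        \<Prod>i < length xs. (xs ! i) ^ (ns ! i))"

end

(* Expand the Weyl density, the squared Vandermonde determinant, over pairs of permutations
   (sigma, tau).  Writing P(u) = (1 - x_1 u) ... (1 - x_k u) with x_r = exp(-i alpha_r), the n-th
   summand is P(1) times the product of P(z_m / z_n) over m <> n, and integrating monomials leaves
   the product over m <> n of the coefficients [u^(tau m - sigma m)] P.  Nothing survives from
   m = n because all exponents sum to zero.  Summing over n turns this into the sum of all cofactors
   of the unitriangular Toeplitz matrix of P, that is, of all entries of its inverse, the Toeplitz
   matrix of 1/P = sum h_m u^m.  Hence the answer is the sum over m < N of (N - m) h_m(x), which is
   h_(N-1)(x, 1, 1).  The second formula expands 1/P in partial fractions; the remaining constants
   come from evaluating the underlying polynomial identity and its derivative at u = 1. *)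
theory Submission
  imports Defs "Jordan_Normal_Form.Determinant"
begin

hide_const (open) Determinants.det Module.smult

subsection \<open>Determinants and cofactors\<close>

lemma cofactor_cong_row:
  assumes "A \<in> carrier_mat n n" "B \<in> carrier_mat n n" "i < n" "j < n"
    and "\<And>i' j'. i' < n \<Longrightarrow> j' < n \<Longrightarrow> i' \<noteq> i \<Longrightarrow> A $$ (i', j') = B $$ (i', j')"
  shows "cofactor A i j = cofactor B i j"
proof -
  have "mat_delete A i j = mat_delete B i j"
    using assms by (intro eq_matI) (auto simp: mat_delete_def)
  thus ?thesis by (simp add: cofactor_def)
qed

text \<open>Laplace expansion along row \<open>a\<close>: its cofactors never see the entries of
  that row, so they are still the cofactors of \<open>A\<close>.\<close>

lemma det_replace_row_ones:
  fixes A :: "'a :: comm_ring_1 mat"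
  assumes A: "A \<in> carrier_mat n n" and a: "a < n"
  shows "det (mat n n (\<lambda>(i, j). if i = a then 1 else A $$ (i, j))) = (\<Sum>b<n. cofactor A a b)"
proof -
  let ?B = "mat n n (\<lambda>(i, j). if i = a then 1 else A $$ (i, j))"
  have "det ?B = (\<Sum>b<n. ?B $$ (a, b) * cofactor ?B a b)"
    by (rule laplace_expansion_row) (use a in auto)
  also have "\<dots> = (\<Sum>b<n. cofactor A a b)"
    using A a by (intro sum.cong refl) (auto intro!: cofactor_cong_row)
  finally show ?thesis .
qed

text \<open>Omitting the factor at \<open>n\<close> amounts to replacing row
  \<open>\<sigma> n\<close> of \<open>T\<close> by ones. For fixed \<sigma> the sum over \<tau> is
  then the determinant of this matrix with its rows permuted by \<sigma>, and the two signs of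
  \<sigma> cancel. Each \<sigma> gives the same total, hence the factor
  \<open>fact N\<close>.\<close>

lemma sum_signed_perm_pairs_omitting_one:
  fixes T :: "'a :: {comm_ring_1, semiring_char_0} mat"
  assumes T: "T \<in> carrier_mat N N"
  shows "(\<Sum>n<N. \<Sum>\<sigma> | \<sigma> permutes {0..<N}. \<Sum>\<tau> | \<tau> permutes {0..<N}.
            signof \<sigma> * signof \<tau> * (\<Prod>m\<in>{..<N} - {n}. T $$ (\<sigma> m, \<tau> m)))
         = fact N * (\<Sum>a<N. \<Sum>b<N. cofactor T a b)"
proof -
  define R where "R a = mat N N (\<lambda>(i, j). if i = a then 1 else T $$ (i, j))" for a
  have R: "R a \<in> carrier_mat N N" for a by (simp add: R_def)
  have inner: "(\<Sum>\<tau> | \<tau> permutes {0..<N}.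
            signof \<sigma> * signof \<tau> * (\<Prod>m\<in>{..<N} - {n}. T $$ (\<sigma> m, \<tau> m))) = det (R (\<sigma> n))"
    if n: "n < N" and \<sigma>: "\<sigma> permutes {0..<N}" for n \<sigma>
  proof -
    have \<sigma>_lt: "\<sigma> m < N \<longleftrightarrow> m < N" for m
      using permutes_in_image[OF \<sigma>, of m] by simp
    have inj: "\<sigma> m = \<sigma> n \<longleftrightarrow> m = n" for m
      by (rule inj_eq[OF permutes_inj[OF \<sigma>]])
    \<comment> \<open>By injectivity of \<sigma>, row \<open>\<sigma> n\<close> is hit only at
      \<open>m = n\<close>, where the row of ones supplies the factor 1.\<close>
    have "(\<Prod>m\<in>{..<N} - {n}. T $$ (\<sigma> m, \<tau> m)) = (\<Prod>m=0..<N. R (\<sigma> n) $$ (\<sigma> m, \<tau> m))"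
      if \<tau>: "\<tau> permutes {0..<N}" for \<tau>
    proof -
      have \<tau>_lt: "\<tau> m < N \<longleftrightarrow> m < N" for m
        using permutes_in_image[OF \<tau>, of m] by simp
      show ?thesis
        by (rule prod.mono_neutral_cong_left) (use n in \<open>auto simp: R_def \<sigma>_lt \<tau>_lt inj\<close>)
    qed
    hence "(\<Sum>\<tau> | \<tau> permutes {0..<N}.
            signof \<sigma> * signof \<tau> * (\<Prod>m\<in>{..<N} - {n}. T $$ (\<sigma> m, \<tau> m)))
        = (\<Sum>\<tau> | \<tau> permutes {0..<N}.
            signof \<sigma> * (signof \<tau> * (\<Prod>m=0..<N. R (\<sigma> n) $$ (\<sigma> m, \<tau> m))))"
      by (intro sum.cong) (auto simp: mult.assoc)
    also have "\<dots> = signof \<sigma> * det (mat N N (\<lambda>(i, j). R (\<sigma> n) $$ (\<sigma> i, j)))"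
    proof -
      have \<tau>_lt: "\<tau> permutes {0..<N} \<Longrightarrow> i < N \<Longrightarrow> \<tau> i < N" for \<tau> i
        using permutes_in_image[of \<tau> "{0..<N}" i] by simp
      show ?thesis
        unfolding sum_distrib_left[symmetric]
        by (subst det_def'[of _ N])
           (auto intro!: sum.cong prod.cong arg_cong2[where f = "(*)"] simp: \<tau>_lt)
    qed
    also have "\<dots> = signof \<sigma> * (signof \<sigma> * det (R (\<sigma> n)))"
      by (subst det_permute_rows[OF R \<sigma>]) simp
    also have "\<dots> = det (R (\<sigma> n))"
      by (simp add: sign_def)
    finally show ?thesis .
  qed
  have "(\<Sum>n<N. \<Sum>\<sigma> | \<sigma> permutes {0..<N}. \<Sum>\<tau> | \<tau> permutes {0..<N}.
            signof \<sigma> * signof \<tau> * (\<Prod>m\<in>{..<N} - {n}. T $$ (\<sigma> m, \<tau> m)))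
        = (\<Sum>n<N. \<Sum>\<sigma> | \<sigma> permutes {0..<N}. det (R (\<sigma> n)))"
    by (intro sum.cong refl inner) auto
  also have "\<dots> = (\<Sum>\<sigma> | \<sigma> permutes {0..<N}. \<Sum>n<N. det (R (\<sigma> n)))"
    by (rule sum.swap)
  \<comment> \<open>As \<open>n\<close> varies, \<open>\<sigma> n\<close> runs once through all
    rows, so the dependence on \<sigma> disappears.\<close>
  also have "\<dots> = (\<Sum>\<sigma> | \<sigma> permutes {0..<N}. \<Sum>a<N. det (R a))"
    by (intro sum.cong refl sum.reindex_bij_betw permutes_imp_bij)
       (auto simp: atLeast0LessThan)
  also have "\<dots> = fact N * (\<Sum>a<N. det (R a))"
    by (simp add: card_permutations[of "{0..<N}" N])
  also have "(\<Sum>a<N. det (R a)) = (\<Sum>a<N. \<Sum>b<N. cofactor T a b)"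
    unfolding R_def by (intro sum.cong refl det_replace_row_ones[OF T]) auto
  finally show ?thesis .
qed

text \<open>Upper triangular Toeplitz matrices multiply like power series truncated at order
  \<open>N\<close>, so the matrix of \<open>G\<close> inverts that of \<open>F\<close>. The latter
  has determinant 1, so its adjugate is the matrix of \<open>G\<close>; summing its entries column
  by column yields partial sums of the coefficients of \<open>G\<close>.\<close>

lemma sum_fps_toeplitz_cofactors:
  fixes F G :: "'a :: comm_ring_1 fps"
  assumes FG: "F * G = 1" and F0: "fps_nth F 0 = 1"
  shows "(\<Sum>a<N. \<Sum>b<N. cofactor (mat N N (\<lambda>(i, j). if i \<le> j then fps_nth F (j - i) else 0)) a b)
         = (\<Sum>a<N. \<Sum>i\<le>a. fps_nth G i)"
proof -
  define toep where "toep H = mat N N (\<lambda>(i, j). if i \<le> j then fps_nth H (j - i) else (0::'a))" for H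
  have carrier: "toep H \<in> carrier_mat N N" for H by (simp add: toep_def)
  have "toep F * toep G = 1\<^sub>m N"
  proof (rule eq_matI)
    fix i j assume "i < dim_row (1\<^sub>m N :: 'a mat)" "j < dim_col (1\<^sub>m N :: 'a mat)"
    hence ij: "i < N" "j < N" by simp_all
    have "row (toep F) i \<bullet> col (toep G) j =
        (\<Sum>l = 0..<N. if i \<le> l \<and> l \<le> j then fps_nth F (l - i) * fps_nth G (j - l) else 0)"
      using ij by (auto simp: scalar_prod_def toep_def intro!: sum.cong)
    also have "\<dots> = (\<Sum>l\<in>{i..j}. fps_nth F (l - i) * fps_nth G (j - l))"
      using ij by (intro sum.mono_neutral_cong_right) auto
    also have "\<dots> = (if i = j then 1 else 0)"
    proof (cases "i \<le> j")
      case True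
      \<comment> \<open>Shifting \<open>l\<close> by \<open>i\<close> makes the entry a Cauchy
        product coefficient.\<close>
      have "(\<Sum>l\<in>{i..j}. fps_nth F (l - i) * fps_nth G (j - l))
          = (\<Sum>p=0..j-i. fps_nth F p * fps_nth G (j - i - p))"
        by (rule sum.reindex_bij_witness[of _ "\<lambda>p. p + i" "\<lambda>l. l - i"]) (use True in auto)
      also have "\<dots> = fps_nth (F * G) (j - i)" by (simp add: fps_mult_nth)
      finally show ?thesis using True by (auto simp: FG)
    qed auto
    finally show "(toep F * toep G) $$ (i, j) = 1\<^sub>m N $$ (i, j)"
      using ij carrier[of F] carrier[of G] by simp
  qed (use carrier in auto)
  moreover have "det (toep F) = 1"
    by (subst det_upper_triangular[of _ N])
       (auto simp: toep_def upper_triangular_def prod_list_diag_prod F0)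
  ultimately have adj_eq: "adj_mat (toep F) = toep G"
  proof -
    assume inv: "toep F * toep G = 1\<^sub>m N" and "det (toep F) = 1"
    hence adj: "adj_mat (toep F) * toep F = 1\<^sub>m N" "adj_mat (toep F) \<in> carrier_mat N N"
      using adj_mat[OF carrier[of F]] by (auto simp: smult_mat_def intro!: eq_matI)
    \<comment> \<open>The adjugate is a left inverse and \<open>toep G\<close> a right inverse;
      associativity identifies them.\<close>
    have "adj_mat (toep F) = adj_mat (toep F) * (toep F * toep G)"
      using adj(2) by (simp add: inv)
    also have "\<dots> = toep G"
      using adj carrier by (simp add: left_mult_one_mat[OF carrier] flip: assoc_mult_mat[of _ N N _ N _ N])
    finally show ?thesis .
  qed
  \<comment> \<open>The adjugate is the transposed cofactor matrix, so the support condition turns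
    into \<open>b \<le> a\<close>.\<close>
  hence cof: "cofactor (toep F) a b = (if b \<le> a then fps_nth G (a - b) else 0)" if "a < N" "b < N" for a b
  proof -
    have "cofactor (toep F) a b = adj_mat (toep F) $$ (b, a)"
      using that carrier[of F] by (simp add: adj_mat_def)
    thus ?thesis unfolding adj_eq using that by (simp add: toep_def)
  qed
  have row_sum: "(\<Sum>b<N. cofactor (toep F) a b) = (\<Sum>i\<le>a. fps_nth G i)" if "a < N" for a
  proof -
    have "(\<Sum>b<N. cofactor (toep F) a b) = (\<Sum>b\<le>a. fps_nth G (a - b))"
      using that by (intro sum.mono_neutral_cong_right) (auto simp: cof)
    also have "\<dots> = (\<Sum>i\<le>a. fps_nth G i)"
      by (rule sum.reindex_bij_witness[of _ "\<lambda>i. a - i" "\<lambda>i. a - i"]) auto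
    finally show ?thesis .
  qed
  show ?thesis unfolding toep_def[symmetric] by (intro sum.cong refl row_sum) auto
qed

section \<open>The Vandermonde determinant\<close>

text \<open>Multiplying on the right by the unitriangular coefficient matrix of the Newton
  polynomials \<open>p j\<close> keeps the determinant and produces the entries
  \<open>poly (p j) (z i)\<close>. These vanish for \<open>i < j\<close>, so the product is lower
  triangular and its diagonal gives the formula.\<close>

lemma det_vandermonde:
  fixes z :: "nat \<Rightarrow> 'a :: idom"
  shows "det (mat N N (\<lambda>(i, j). z i ^ j)) = (\<Prod>i<N. \<Prod>m<i. z i - z m)"
proof -
  define V where "V = mat N N (\<lambda>(i, j). z i ^ j)"
  define p where "p j = (\<Prod>m<j. [:- z m, 1:])" for j
  define U where "U = mat N N (\<lambda>(i, j). coeff (p j) i)"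
  have deg: "degree (p j) = j" for j
    by (simp add: p_def degree_prod_eq_sum_degree)
  have lead: "coeff (p j) j = 1" for j
    using lead_coeff_prod[of "\<lambda>m. [:- z m, 1:]" "{..<j}"] by (simp add: deg flip: p_def)
  have poly_p: "poly (p j) u = (\<Prod>m<j. u - z m)" for j u
    by (simp add: p_def poly_prod)
  have carrier: "V \<in> carrier_mat N N" "U \<in> carrier_mat N N" by (simp_all add: V_def U_def)
  have VU: "V * U = mat N N (\<lambda>(i, j). poly (p j) (z i))"
  proof (rule eq_matI)
    fix i j assume "i < dim_row (mat N N (\<lambda>(i, j). poly (p j) (z i)))"
      "j < dim_col (mat N N (\<lambda>(i, j). poly (p j) (z i)))"
    hence ij: "i < N" "j < N" by simp_all
    have "poly (p j) (z i) = (\<Sum>l\<le>j. coeff (p j) l * z i ^ l)"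
      by (simp add: poly_altdef deg)
    also have "\<dots> = (\<Sum>l=0..<N. coeff (p j) l * z i ^ l)"
      using ij by (intro sum.mono_neutral_left) (auto simp: coeff_eq_0 deg)
    finally show "(V * U) $$ (i, j) = mat N N (\<lambda>(i, j). poly (p j) (z i)) $$ (i, j)"
      using ij by (simp add: V_def U_def scalar_prod_def mult.commute)
  qed (use carrier in auto)
  have "det U = 1"
    by (subst det_upper_triangular[of _ N])
       (auto simp: U_def upper_triangular_def prod_list_diag_prod lead coeff_eq_0 deg)
  moreover have "det (V * U) = (\<Prod>i<N. \<Prod>m<i. z i - z m)"
    unfolding VU
    by (subst det_lower_triangular[of N]) (auto simp: prod_list_diag_prod poly_p atLeast0LessThan)
  ultimately show ?thesis
    using det_mult[OF carrier] by (simp add: V_def)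
qed

subsection \<open>Trigonometric integrals\<close>

lemma prod_cis:
  "finite A \<Longrightarrow> (\<Prod>x\<in>A. cis (f x)) = cis (\<Sum>x\<in>A. f x)"
  by (induction A rule: finite_induct) (simp_all add: cis_mult)

text \<open>Orthogonality of the characters of the circle: a nonzero integer frequency has a
  periodic antiderivative, whose boundary values cancel.\<close>

lemma has_bochner_integral_cis_mult:
  "has_bochner_integral (restrict_space lborel {- pi..<pi}) (\<lambda>t. cis (of_int e * t))
     (if e = 0 then 2 * pi else 0)"
proof -
  have "has_bochner_integral lborel (\<lambda>t. indicator {- pi..pi} t *\<^sub>R cis (of_int e * t))
     (if e = 0 then 2 * pi else 0)"
  proof (cases "e = 0")
    case True
    have "has_bochner_integral lborel (\<lambda>t. indicator {- pi..pi} t *\<^sub>R (1::complex)) (measure lborel {-pi..pi} *\<^sub>R 1)"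
      by (intro has_bochner_integral_indicator) auto
    thus ?thesis using True by (simp add: scaleR_conv_of_real)
  next
    case False
    have "has_bochner_integral lborel (\<lambda>t. indicator {- pi..pi} t *\<^sub>R cis (of_int e * t))
       (cis (of_int e * pi) / (\<i> * of_int e) - cis (of_int e * (- pi)) / (\<i> * of_int e))"
    proof (rule has_bochner_integral_FTC_Icc)
      fix t :: real
      show "((\<lambda>t. cis (of_int e * t) / (\<i> * of_int e)) has_vector_derivative cis (of_int e * t))
              (at t within {- pi..pi})"
        unfolding has_vector_derivative_def
        using False by (auto intro!: derivative_eq_intros simp: fun_eq_iff scaleR_conv_of_real mult_ac)
    qed (auto intro!: continuous_intros)
    moreover have "cis (of_int e * pi) = cis (of_int e * (- pi))"
    proof -
      have "cis (of_int e * pi) = cis (of_int e * (- pi)) * cis (2 * pi * of_int e)"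
        by (simp add: cis_mult algebra_simps)
      also have "cis (2 * pi * of_int e) = 1" by (rule cis_multiple_2pi) auto
      finally show ?thesis by simp
    qed
    ultimately show ?thesis using False by simp
  qed
  \<comment> \<open>The fundamental theorem of calculus speaks of the closed interval, the
    eigenphase space of the half-open one; they differ by the null set \<open>{pi}\<close>.\<close>
  also have "?this \<longleftrightarrow> has_bochner_integral lborel (\<lambda>t. indicator {- pi..<pi} t *\<^sub>R cis (of_int e * t))
     (if e = 0 then 2 * pi else 0)"
  proof (rule has_bochner_integral_cong_AE)
    show "AE t in lborel. indicator {- pi..pi} t *\<^sub>R cis (of_int e * t)
             = indicator {- pi..<pi} t *\<^sub>R cis (of_int e * t)"
      using AE_lborel_singleton[of pi] by eventually_elim (auto simp: indicator_def)
  qed (auto intro!: borel_measurable_scaleR borel_measurable_indicator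
          borel_measurable_continuous_onI[of "\<lambda>t. cis (_ t)"] continuous_intros)
  finally show ?thesis
    by (simp add: has_bochner_integral_iff integrable_restrict_space integral_restrict_space)
qed

lemma has_bochner_integral_prod_cis_mult:
  assumes "finite I"
  shows "has_bochner_integral (\<Pi>\<^sub>M j\<in>I. restrict_space lborel {- pi..<pi})
     (\<lambda>\<theta>. \<Prod>i\<in>I. cis (of_int (e i) * \<theta> i))
     (if \<forall>i\<in>I. e i = 0 then (2 * pi) ^ card I else 0)"
proof -
  \<comment> \<open>Product integration requires sigma-finite factors; here each factor is even a
    finite measure.\<close>
  interpret product_sigma_finite "\<lambda>j. restrict_space lborel {- pi..<pi}"
  proof
    interpret finite_measure "restrict_space lborel {- pi..<pi}"
      by (rule finite_measureI) (simp add: emeasure_restrict_space space_restrict_space)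
    show "\<exists>A. countable A \<and> A \<subseteq> sets (restrict_space lborel {- pi..<pi})
        \<and> \<Union> A = space (restrict_space lborel {- pi..<pi})
        \<and> (\<forall>a\<in>A. emeasure (restrict_space lborel {- pi..<pi}) a \<noteq> \<infinity>)"
      by (rule sigma_finite_countable)
  qed
  have 1: "integrable (restrict_space lborel {- pi..<pi}) (\<lambda>t. cis (of_int (e i) * t))" for i
    using has_bochner_integral_cis_mult[of "e i"] by (simp add: has_bochner_integral_iff)
  have 2: "integral\<^sup>L (restrict_space lborel {- pi..<pi}) (\<lambda>t. cis (of_int (e i) * t))
      = (if e i = 0 then 2 * pi else 0)" for i
    using has_bochner_integral_cis_mult[of "e i"] by (simp add: has_bochner_integral_iff)
  have "(\<Prod>i\<in>I. complex_of_real (if e i = 0 then 2 * pi else 0))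
      = (if \<forall>i\<in>I. e i = 0 then (2 * pi) ^ card I else 0)"
    using assms by (auto simp: prod_zero_iff)
  thus ?thesis
    using product_integrable_prod[OF assms 1] product_integral_prod[OF assms 1]
    by (simp add: has_bochner_integral_iff 2)
qed

text \<open>After expanding every factor of the second product, orthogonality keeps only the
  monomial that cancels \<open>e\<close> at each \<open>m \<noteq> n\<close>, which selects the
  coefficient of \<open>P\<close> at \<open>- e m\<close>. Cancellation at \<open>n\<close> is then
  automatic because the total exponent is zero, so \<open>n\<close> leaves no factor.\<close>

lemma has_bochner_integral_trig_poly_pinned:
  fixes P :: "complex poly" and e :: "nat \<Rightarrow> int"
  assumes n: "n \<in> I" and fin: "finite I" and e0: "(\<Sum>i\<in>I. e i) = 0"
  shows "has_bochner_integral (\<Pi>\<^sub>M j\<in>I. restrict_space lborel {- pi..<pi})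
     (\<lambda>\<theta>. (\<Prod>i\<in>I. cis (of_int (e i) * \<theta> i)) * (\<Prod>m\<in>I - {n}. poly P (cis (\<theta> m - \<theta> n))))
     (of_real ((2 * pi) ^ card I) * (\<Prod>m\<in>I - {n}. if e m \<le> 0 then coeff P (nat (- e m)) else 0))"
    (is "has_bochner_integral ?M _ _")
proof -
  define A where "A = I - {n}"
  have A: "finite A" "n \<notin> A" and I: "I = insert n A" using n fin by (auto simp: A_def)
  define Fs where "Fs = (A \<rightarrow>\<^sub>E {..degree P})"
  \<comment> \<open>If \<open>f m\<close> is the power chosen from factor \<open>m\<close>, then
    \<open>g f\<close> is the resulting exponent vector: the ratio of eigenvalues \<open>m\<close>
    and \<open>n\<close> contributes \<open>f m\<close> at \<open>m\<close> and \<open>- f m\<close>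
    at \<open>n\<close>.\<close>
  define g where "g f i = (if i = n then - (\<Sum>m\<in>A. int (f m)) else int (f i))" for f i
  define c where "c f = (\<Prod>m\<in>A. coeff P (f m))" for f
  have expand: "(\<Prod>i\<in>I. cis (of_int (e i) * \<theta> i)) * (\<Prod>m\<in>A. poly P (cis (\<theta> m - \<theta> n)))
     = (\<Sum>f\<in>Fs. c f * (\<Prod>i\<in>I. cis (of_int (e i + g f i) * \<theta> i)))" for \<theta> :: "nat \<Rightarrow> real"
  proof -
    have "(\<Prod>m\<in>A. poly P (cis (\<theta> m - \<theta> n)))
        = (\<Sum>f\<in>Fs. \<Prod>m\<in>A. coeff P (f m) * cis (\<theta> m - \<theta> n) ^ f m)"
      unfolding Fs_def poly_altdef by (rule prod_sum_PiE) (use A in auto)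
    also have "\<dots> = (\<Sum>f\<in>Fs. c f * (\<Prod>i\<in>I. cis (of_int (g f i) * \<theta> i)))"
    proof (rule sum.cong)
      fix f
      have "(\<Prod>m\<in>A. cis (\<theta> m - \<theta> n) ^ f m)
          = (\<Prod>m\<in>A. cis (of_int (g f m) * \<theta> m)) * (\<Prod>m\<in>A. cis (- (f m * \<theta> n)))"
        unfolding prod.distrib[symmetric]
        using A by (intro prod.cong) (auto simp: g_def Complex.DeMoivre cis_mult algebra_simps)
      also have "(\<Prod>m\<in>A. cis (- (f m * \<theta> n))) = cis (of_int (g f n) * \<theta> n)"
        by (simp add: prod_cis[OF A(1)] g_def sum_negf sum_distrib_right)
      finally show "(\<Prod>m\<in>A. coeff P (f m) * cis (\<theta> m - \<theta> n) ^ f m)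
         = c f * (\<Prod>i\<in>I. cis (of_int (g f i) * \<theta> i))"
        using A by (simp add: prod.distrib c_def I)
    qed auto
    finally have "(\<Prod>m\<in>A. poly P (cis (\<theta> m - \<theta> n)))
        = (\<Sum>f\<in>Fs. c f * (\<Prod>i\<in>I. cis (of_int (g f i) * \<theta> i)))" .
    moreover have "cis (of_int (e i + g f i) * \<theta> i) = cis (of_int (e i) * \<theta> i) * cis (of_int (g f i) * \<theta> i)" for f i
      by (simp add: cis_mult ring_distribs)
    ultimately show ?thesis
      by (simp add: sum_distrib_left prod.distrib mult_ac)
  qed
  have ex: "(\<forall>i\<in>I. e i + g f i = 0) \<longleftrightarrow> (\<forall>m\<in>A. int (f m) = - e m)" for f
  proof
    assume *: "\<forall>m\<in>A. int (f m) = - e m"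
    have "e n + g f n = e n - (\<Sum>m\<in>A. - e m)" using * by (simp add: g_def)
    also have "\<dots> = 0" using e0 A by (simp add: I sum_negf)
    finally show "\<forall>i\<in>I. e i + g f i = 0" using * A by (auto simp: I g_def)
  next
    assume *: "\<forall>i\<in>I. e i + g f i = 0"
    show "\<forall>m\<in>A. int (f m) = - e m"
    proof
      fix m assume "m \<in> A"
      hence "m \<noteq> n" "e m + g f m = 0" using * A by (auto simp: I)
      thus "int (f m) = - e m" by (simp add: g_def)
    qed
  qed
  have "has_bochner_integral ?M
     (\<lambda>\<theta>. (\<Prod>i\<in>I. cis (of_int (e i) * \<theta> i)) * (\<Prod>m\<in>A. poly P (cis (\<theta> m - \<theta> n))))
     (\<Sum>f\<in>Fs. c f * of_real (if \<forall>i\<in>I. e i + g f i = 0 then (2 * pi) ^ card I else 0))"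
    unfolding expand
    by (intro has_bochner_integral_sum has_bochner_integral_mult_right
          has_bochner_integral_prod_cis_mult[OF fin])
  also have "(\<Sum>f\<in>Fs. c f * of_real (if \<forall>i\<in>I. e i + g f i = 0 then (2 * pi) ^ card I else 0))
     = of_real ((2 * pi) ^ card I) * (\<Sum>f\<in>Fs. \<Prod>m\<in>A. if int (f m) = - e m then coeff P (f m) else 0)"
    unfolding sum_distrib_left ex
    using A by (intro sum.cong refl) (auto simp: c_def prod_zero_iff)
  \<comment> \<open>The constraint acts on each \<open>m\<close> separately, so the sum over
    \<open>f\<close> factors again.\<close>
  also have "(\<Sum>f\<in>Fs. \<Prod>m\<in>A. if int (f m) = - e m then coeff P (f m) else 0)
     = (\<Prod>m\<in>A. \<Sum>p\<le>degree P. if int p = - e m then coeff P p else 0)"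
    unfolding Fs_def by (rule prod_sum_PiE[symmetric]) (use A in auto)
  also have "\<dots> = (\<Prod>m\<in>A. if e m \<le> 0 then coeff P (nat (- e m)) else 0)"
  proof (rule prod.cong)
    fix m
    have "(\<Sum>p\<le>degree P. if int p = - e m then coeff P p else 0)
        = (\<Sum>p\<le>degree P. if p = nat (- e m) then (if e m \<le> 0 then coeff P p else 0) else 0)"
      by (intro sum.cong) auto
    also have "\<dots> = (if e m \<le> 0 then coeff P (nat (- e m)) else 0)"
      by (auto simp: coeff_eq_0)
    finally show "(\<Sum>p\<le>degree P. if int p = - e m then coeff P p else 0)
       = (if e m \<le> 0 then coeff P (nat (- e m)) else 0)" .
  qed auto
  finally show ?thesis by (simp only: A_def)
qed

subsection \<open>Complete homogeneous polynomials and partial fractions\<close>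

lemma fps_geometric_mult:
  fixes x :: "'a :: comm_ring_1"
  shows "(1 - fps_const x * fps_X) * Abs_fps (\<lambda>n. x ^ n) = 1"
  by (rule fps_ext) (auto simp: ring_distribs mult.assoc power_eq_if)

text \<open>Sort the exponent lists by their head \<open>j\<close>. The result is a Cauchy product
  with the geometric series of \<open>x\<close>, which drives the induction for the generating
  function.\<close>

lemma complete_homogeneous_Cons:
  fixes xs :: "'a :: comm_semiring_1 list"
  shows "complete_homogeneous m (x # xs) = (\<Sum>j=0..m. x ^ j * complete_homogeneous (m - j) xs)"
proof -
  define S where "S m = {ns :: nat list. length ns = length xs \<and> sum_list ns = m}" for m
  have fin: "finite (S m)" for m
    by (rule finite_subset[OF _ finite_lists_length_eq[of "{..m}" "length xs"]])
       (auto simp: S_def dest: member_le_sum_list)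
  have "complete_homogeneous m (x # xs) =
     (\<Sum>ns | length ns = length (x # xs) \<and> sum_list ns = m. \<Prod>i<Suc (length xs). (x # xs) ! i ^ ns ! i)"
    by (simp add: complete_homogeneous_def)
  also have "\<dots> = (\<Sum>(j, ns)\<in>(SIGMA j:{0..m}. S (m - j)). x ^ j * (\<Prod>i<length xs. xs ! i ^ ns ! i))"
    by (rule sum.reindex_bij_witness[of _ "\<lambda>(j, ns). j # ns" "\<lambda>ns. (hd ns, tl ns)"])
       (auto simp: S_def length_Suc_conv prod.lessThan_Suc_shift simp del: prod.lessThan_Suc)
  also have "\<dots> = (\<Sum>j=0..m. x ^ j * complete_homogeneous (m - j) xs)"
    by (simp add: sum.Sigma[symmetric] fin sum_distrib_left complete_homogeneous_def S_def[symmetric])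
  finally show ?thesis .
qed

text \<open>The generating function of the complete homogeneous polynomials. Geometric series are
  given by their coefficients instead of as inverses, so the identity makes sense over any
  commutative semiring.\<close>

lemma fps_nth_prod_geometric:
  fixes xs :: "'a :: comm_semiring_1 list"
  shows "fps_nth (\<Prod>x\<leftarrow>xs. Abs_fps (\<lambda>n. x ^ n)) m = complete_homogeneous m xs"
proof (induction xs arbitrary: m)
  case Nil
  have "{ns :: nat list. ns = [] \<and> sum_list ns = m} = (if m = 0 then {[]} else {})" by auto
  thus ?case by (simp add: complete_homogeneous_def)
next
  case (Cons x xs)
  thus ?case by (simp add: complete_homogeneous_Cons fps_mult_nth)
qed

section \<open>Partial fractions and the closed form for distinct variables\<close>

text \<open>This is the partial fraction expansion of the reciprocal of the product of all
  \<open>1 - x r * u\<close>, cleared of denominators. The difference of the two sides has degree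
  below \<open>card I\<close> but vanishes at the \<open>card I\<close> distinct points
  \<open>inverse (x s)\<close>.\<close>

lemma partial_fractions_linear_factors:
  fixes x :: "'b \<Rightarrow> 'a :: field"
  assumes fin: "finite I" and ne: "I \<noteq> {}" and inj: "inj_on x I" and nz: "\<And>r. r \<in> I \<Longrightarrow> x r \<noteq> 0"
  shows "(\<Sum>r\<in>I. smult (1 / (\<Prod>j\<in>I - {r}. 1 - x j / x r)) (\<Prod>j\<in>I - {r}. [:1, - x j:])) = 1"
proof -
  define A where "A r = 1 / (\<Prod>j\<in>I - {r}. 1 - x j / x r)" for r
  define p where "p = (\<Sum>r\<in>I. smult (A r) (\<Prod>j\<in>I - {r}. [:1, - x j:])) - 1"
  have roots: "poly p (inverse (x s)) = 0" if s: "s \<in> I" for s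
  proof -
    \<comment> \<open>For \<open>r \<noteq> s\<close> the product contains the vanishing factor
      \<open>j = s\<close>.\<close>
    have "(\<Sum>r\<in>I. A r * (\<Prod>j\<in>I - {r}. 1 - x j / x s)) = (\<Sum>r\<in>{s}. A r * (\<Prod>j\<in>I - {r}. 1 - x j / x s))"
    proof (rule sum.mono_neutral_right)
      show "\<forall>r\<in>I - {s}. A r * (\<Prod>j\<in>I - {r}. 1 - x j / x s) = 0"
      proof
        fix r assume r: "r \<in> I - {s}"
        have "(\<Prod>j\<in>I - {r}. 1 - x j / x s) = 0"
          by (rule prod_zero) (use r s fin nz in auto)
        thus "A r * (\<Prod>j\<in>I - {r}. 1 - x j / x s) = 0" by simp
      qed
    qed (use s fin in auto)
    also have "\<dots> = 1"
    proof -
      have "(\<Prod>j\<in>I - {s}. 1 - x j / x s) \<noteq> 0"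
        using fin s nz inj by (auto simp: prod_zero_iff field_simps dest: inj_onD)
      thus ?thesis by (simp add: A_def)
    qed
    finally show ?thesis by (simp add: p_def poly_sum poly_prod field_simps)
  qed
  have "p = 0"
  proof (rule ccontr)
    assume p: "p \<noteq> 0"
    have "degree (smult (A r) (\<Prod>j\<in>I - {r}. [:1, - x j:])) \<le> card I - 1" if "r \<in> I" for r
    proof -
      have "degree (\<Prod>j\<in>I - {r}. [:1, - x j:]) \<le> (\<Sum>j\<in>I - {r}. degree [:1, - x j:])"
        using degree_prod_sum_le[of "I - {r}" "\<lambda>j. [:1, - x j:]"] fin by (simp add: o_def)
      also have "\<dots> \<le> (\<Sum>j\<in>I - {r}. 1)" by (intro sum_mono) auto
      also have "\<dots> = card I - 1" using that fin by simp
      finally show ?thesis by (rule order.trans[OF degree_smult_le])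
    qed
    hence "degree p \<le> card I - 1"
      unfolding p_def by (intro degree_diff_le degree_sum_le fin) auto
    moreover have "card I > 0" using fin ne by (simp add: card_gt_0_iff)
    ultimately have "degree p < card I" by linarith
    moreover have "card I = card ((\<lambda>r. inverse (x r)) ` I)"
      using inj by (intro card_image[symmetric]) (auto simp: inj_on_def)
    moreover have "\<dots> \<le> card {u. poly p u = 0}"
      by (intro card_mono poly_roots_finite p) (use roots in auto)
    moreover have "\<dots> \<le> degree p" by (rule card_poly_roots_bound[OF p])
    ultimately show False by linarith
  qed
  thus ?thesis by (simp add: p_def A_def)
qed

text \<open>The double sum gives \<open>x ^ i\<close> the weight \<open>N - i\<close>. The induction
  step adds one geometric sum, brought to the denominator \<open>(1 - x) ^ 2\<close>.\<close>

lemma sum_power_weighted: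
  fixes x :: "'a :: field"
  assumes "x \<noteq> 1"
  shows "(\<Sum>a<N. \<Sum>i\<le>a. x ^ i) = (x ^ (N + 1) - of_nat (N + 1) * x + of_nat N) / (1 - x) ^ 2"
proof (induction N)
  case (Suc N)
  have x: "1 - x \<noteq> 0" using assms by simp
  have "(\<Sum>i\<le>N. x ^ i) = (1 - x ^ Suc N) / (1 - x)"
    using assms by (simp add: sum_gp0)
  hence "(\<Sum>a<Suc N. \<Sum>i\<le>a. x ^ i) = (x ^ (N + 1) - of_nat (N + 1) * x + of_nat N) / (1 - x) ^ 2
     + (1 - x) * (1 - x ^ Suc N) / (1 - x) ^ 2"
    using Suc x by (simp add: power2_eq_square)
  also have "\<dots> = (x ^ (Suc N + 1) - of_nat (Suc N + 1) * x + of_nat (Suc N)) / (1 - x) ^ 2"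
    unfolding add_divide_distrib[symmetric] by (rule arg_cong2[where f = "(/)"]) (simp_all add: algebra_simps)
  finally show ?case .
qed simp

text \<open>Partial fractions write the coefficients of the product as combinations of powers
  \<open>x r ^ i\<close>, which the weighted power sum evaluates. What remains are the constants
  \<open>\<Sum>r\<in>I. B r\<close> and \<open>\<Sum>r\<in>I. B r / (1 - x r)\<close>, where
  \<open>B r\<close> is the value at 1 of the \<open>r\<close>-th summand of the identity
  \<open>pf\<close>.\<close>

lemma prod_times_sum_prod_geometric_coeffs:
  fixes x :: "'b \<Rightarrow> 'a :: field"
  assumes fin: "finite I" and ne: "I \<noteq> {}" and inj: "inj_on x I"
    and nz: "\<And>r. r \<in> I \<Longrightarrow> x r \<noteq> 0" and n1: "\<And>r. r \<in> I \<Longrightarrow> x r \<noteq> 1"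
  shows "(\<Prod>r\<in>I. 1 - x r) * (\<Sum>a<N. \<Sum>i\<le>a. fps_nth (\<Prod>r\<in>I. Abs_fps (\<lambda>n. x r ^ n)) i)
    = (\<Sum>r\<in>I. x r ^ (N + card I) / (1 - x r) * (\<Prod>j\<in>I - {r}. (1 - x j) / (x r - x j)))
      + of_nat N + of_nat (card I) - (\<Sum>l\<in>I. 1 / (1 - x l))"
proof -
  define A where "A r = 1 / (\<Prod>j\<in>I - {r}. 1 - x j / x r)" for r
  define B where "B r = A r * (\<Prod>j\<in>I - {r}. 1 - x j)" for r
  define S where "S = (\<Sum>l\<in>I. 1 / (1 - x l))"
  define G where "G = (\<Prod>r\<in>I. Abs_fps (\<lambda>n. x r ^ n))"
  have pf: "(\<Sum>r\<in>I. smult (A r) (\<Prod>j\<in>I - {r}. [:1, - x j:])) = 1"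
    unfolding A_def by (rule partial_fractions_linear_factors[OF fin ne inj nz])
  have geo: "fps_of_poly [:1, - x r:] * Abs_fps (\<lambda>n. x r ^ n) = 1" for r
    using fps_geometric_mult[of "x r"] by (simp add: fps_of_poly_linear' flip: fps_const_neg)
  \<comment> \<open>Multiplying by this expansion of 1 cancels, in summand \<open>r\<close>, every
    geometric series except the \<open>r\<close>-th.\<close>
  have "G = G * fps_of_poly (\<Sum>r\<in>I. smult (A r) (\<Prod>j\<in>I - {r}. [:1, - x j:]))"
    by (simp add: pf)
  also have "\<dots> = (\<Sum>r\<in>I. fps_const (A r) * Abs_fps (\<lambda>n. x r ^ n))"
    unfolding fps_of_poly_sum sum_distrib_left
  proof (rule sum.cong)
    fix r assume r: "r \<in> I"
    have "G = Abs_fps (\<lambda>n. x r ^ n) * (\<Prod>j\<in>I - {r}. Abs_fps (\<lambda>n. x j ^ n))"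
      unfolding G_def using fin r by (rule prod.remove)
    hence "G * fps_of_poly (smult (A r) (\<Prod>j\<in>I - {r}. [:1, - x j:]))
      = fps_const (A r) * Abs_fps (\<lambda>n. x r ^ n) *
          (\<Prod>j\<in>I - {r}. fps_of_poly [:1, - x j:] * Abs_fps (\<lambda>n. x j ^ n))"
      by (simp add: fps_of_poly_smult fps_of_poly_prod prod.distrib mult_ac)
    thus "G * fps_of_poly (smult (A r) (\<Prod>j\<in>I - {r}. [:1, - x j:]))
      = fps_const (A r) * Abs_fps (\<lambda>n. x r ^ n)" by (simp add: geo)
  qed auto
  finally have G_nth: "fps_nth G i = (\<Sum>r\<in>I. A r * x r ^ i)" for i
    by (simp add: fps_sum_nth)
  have "(\<Sum>a<N. \<Sum>i\<le>a. fps_nth G i) = (\<Sum>r\<in>I. A r * (\<Sum>a<N. \<Sum>i\<le>a. x r ^ i))"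
    unfolding G_nth sum_distrib_left by (simp add: sum.swap[of _ I])
  hence "(\<Prod>r\<in>I. 1 - x r) * (\<Sum>a<N. \<Sum>i\<le>a. fps_nth G i)
     = (\<Sum>r\<in>I. (\<Prod>r\<in>I. 1 - x r) * (A r * (\<Sum>a<N. \<Sum>i\<le>a. x r ^ i)))"
    by (simp add: sum_distrib_left)
  \<comment> \<open>The split rests on
    \<open>N - (N + 1) * x = (N + 1) * (1 - x) - 1\<close>.\<close>
  also have "\<dots> = (\<Sum>r\<in>I. B r * x r ^ (N + 1) / (1 - x r) + (of_nat (N + 1) * B r - B r / (1 - x r)))"
  proof (rule sum.cong)
    fix r assume r: "r \<in> I"
    have "(\<Prod>r\<in>I. 1 - x r) = (1 - x r) * (\<Prod>j\<in>I - {r}. 1 - x j)"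
      using fin r by (rule prod.remove)
    moreover have "1 - x r \<noteq> 0" using n1[OF r] by simp
    ultimately show "(\<Prod>r\<in>I. 1 - x r) * (A r * (\<Sum>a<N. \<Sum>i\<le>a. x r ^ i))
       = B r * x r ^ (N + 1) / (1 - x r) + (of_nat (N + 1) * B r - B r / (1 - x r))"
      unfolding sum_power_weighted[OF n1[OF r]] B_def
      by (simp add: divide_simps power2_eq_square) (simp add: algebra_simps)
  qed auto
  also have "\<dots> = (\<Sum>r\<in>I. B r * x r ^ (N + 1) / (1 - x r)) + of_nat (N + 1) * (\<Sum>r\<in>I. B r)
      - (\<Sum>r\<in>I. B r / (1 - x r))"
    by (simp add: sum.distrib sum_subtractf sum_distrib_left)
  \<comment> \<open>Evaluation of \<open>pf\<close> at 1.\<close>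
  also have B_sum: "(\<Sum>r\<in>I. B r) = 1"
    using arg_cong[OF pf, of "\<lambda>p. poly p 1"] by (simp add: poly_sum poly_prod B_def)
  \<comment> \<open>Obtained from the derivative of \<open>pf\<close> at 1, which is zero.\<close>
  also have "(\<Sum>r\<in>I. B r / (1 - x r)) = S - of_nat (card I) + 1"
  proof -
    have deriv: "A r * poly (pderiv (\<Prod>j\<in>I - {r}. [:1, - x j:])) 1
        = B r * (of_nat (card I) - 1 - S) + B r / (1 - x r)" if r: "r \<in> I" for r
    proof -
      have "poly (pderiv (\<Prod>j\<in>I - {r}. [:1, - x j:])) 1
          = (\<Sum>a\<in>I - {r}. (\<Prod>j\<in>I - {r} - {a}. 1 - x j) * - x a)"
        by (simp add: pderiv_prod poly_sum poly_prod pderiv_pCons mult.commute)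
      \<comment> \<open>Logarithmic differentiation: the missing factor is restored through
        \<open>- x a = (1 - x a) * (1 - 1 / (1 - x a))\<close>.\<close>
      also have "\<dots> = (\<Sum>a\<in>I - {r}. (\<Prod>j\<in>I - {r}. 1 - x j) * (1 - 1 / (1 - x a)))"
      proof (rule sum.cong)
        fix a assume a: "a \<in> I - {r}"
        have "(\<Prod>j\<in>I - {r}. 1 - x j) = (1 - x a) * (\<Prod>j\<in>I - {r} - {a}. 1 - x j)"
          by (rule prod.remove) (use a fin in auto)
        moreover have "1 - x a \<noteq> 0" using n1[of a] a by auto
        ultimately show "(\<Prod>j\<in>I - {r} - {a}. 1 - x j) * - x a
            = (\<Prod>j\<in>I - {r}. 1 - x j) * (1 - 1 / (1 - x a))"
          by (simp add: divide_simps)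
      qed auto
      also have "\<dots> = (\<Prod>j\<in>I - {r}. 1 - x j) * (of_nat (card (I - {r})) - (\<Sum>a\<in>I - {r}. 1 / (1 - x a)))"
        by (simp add: sum_distrib_left[symmetric] sum_subtractf)
      also have "(\<Sum>a\<in>I - {r}. 1 / (1 - x a)) = S - 1 / (1 - x r)"
        unfolding S_def using fin r by (simp add: sum_diff1)
      also have "of_nat (card (I - {r})) = (of_nat (card I) - 1 :: 'a)"
        using fin r card_Suc_Diff1[OF fin r] by (metis add_diff_cancel_left' of_nat_Suc)
      finally have pderiv_eq: "poly (pderiv (\<Prod>j\<in>I - {r}. [:1, - x j:])) 1
          = (\<Prod>j\<in>I - {r}. 1 - x j) * (of_nat (card I) - 1 - (S - 1 / (1 - x r)))" .
      show ?thesis unfolding pderiv_eq B_def by (simp add: algebra_simps)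
    qed
    have "pderiv (sum p I) = (\<Sum>r\<in>I. pderiv (p r))" for p :: "'b \<Rightarrow> 'a poly"
      using higher_pderiv_sum[of 1 p I] by simp
    hence "(\<Sum>r\<in>I. A r * poly (pderiv (\<Prod>j\<in>I - {r}. [:1, - x j:])) 1) = 0"
      using arg_cong[OF pf, of "\<lambda>p. poly (pderiv p) 1"]
      by (simp add: pderiv_smult poly_sum pderiv_1)
    hence "(\<Sum>r\<in>I. B r) * (of_nat (card I) - 1 - S) + (\<Sum>r\<in>I. B r / (1 - x r)) = 0"
      by (simp add: deriv sum.distrib sum_distrib_right)
    thus ?thesis unfolding B_sum by (simp add: algebra_simps)
  qed
  \<comment> \<open>Turning each \<open>1 - x j / x r\<close> into \<open>x r - x j\<close> costs
    one power of \<open>x r\<close>; these \<open>card I - 1\<close> powers raise the exponent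
    \<open>N + 1\<close> to \<open>N + card I\<close>.\<close>
  also have "(\<Sum>r\<in>I. B r * x r ^ (N + 1) / (1 - x r))
     = (\<Sum>r\<in>I. x r ^ (N + card I) / (1 - x r) * (\<Prod>j\<in>I - {r}. (1 - x j) / (x r - x j)))"
  proof (rule sum.cong)
    fix r assume r: "r \<in> I"
    have "x r ^ (card I - 1) * (\<Prod>j\<in>I - {r}. (1 - x j) / (x r - x j))
        = (\<Prod>j\<in>I - {r}. x r * ((1 - x j) / (x r - x j)))"
      unfolding prod.distrib using fin r by simp
    also have "\<dots> = (\<Prod>j\<in>I - {r}. (1 - x j) / (1 - x j / x r))"
      using nz[OF r] by (intro prod.cong refl) (auto simp: divide_simps)
    also have "\<dots> = B r" by (simp add: B_def A_def prod_dividef)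
    finally have "B r * x r ^ (N + 1) = x r ^ (N + 1 + (card I - 1)) * (\<Prod>j\<in>I - {r}. (1 - x j) / (x r - x j))"
      unfolding power_add by (simp add: mult_ac)
    moreover have "N + 1 + (card I - 1) = N + card I"
      using fin ne by (simp add: Suc_leI card_gt_0_iff)
    ultimately show "B r * x r ^ (N + 1) / (1 - x r)
       = x r ^ (N + card I) / (1 - x r) * (\<Prod>j\<in>I - {r}. (1 - x j) / (x r - x j))" by simp
  qed auto
  finally show ?thesis by (simp add: G_def S_def)
qed

subsection \<open>Expectations over the unitary group\<close>

abbreviation eigenphase_space :: "nat \<Rightarrow> (nat \<Rightarrow> real) measure" where
  "eigenphase_space N \<equiv> (\<Pi>\<^sub>M j\<in>{1..N}. restrict_space lborel {- pi..<pi})"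

lemma measurable_cis_eigenphase:
  assumes "j \<in> {1..N}"
  shows "(\<lambda>\<theta>. cis (\<theta> j)) \<in> borel_measurable (eigenphase_space N)"
proof -
  have "(\<lambda>\<theta>. \<theta> j) \<in> eigenphase_space N \<rightarrow>\<^sub>M restrict_space lborel {- pi..<pi}"
    using assms by (rule measurable_component_singleton)
  moreover have "cis \<in> borel_measurable (restrict_space lborel {- pi..<pi})"
    by (intro measurable_restrict_space1) (auto intro!: borel_measurable_continuous_onI continuous_intros)
  ultimately show ?thesis by (rule measurable_compose)
qed

lemma weyl_density_nonneg: "weyl_density N \<theta> \<ge> 0"
  by (auto simp: weyl_density_def split_def intro!: divide_nonneg_nonneg prod_nonneg)

lemma measurable_weyl_density: "weyl_density N \<in> borel_measurable (eigenphase_space N)"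
proof -
  have "(\<lambda>\<theta>. weyl_density N \<theta>) \<in> borel_measurable (eigenphase_space N)"
    unfolding weyl_density_def split_def
    by (intro borel_measurable_times borel_measurable_const borel_measurable_prod
          borel_measurable_power borel_measurable_norm[THEN measurable_compose_rev]
          borel_measurable_diff measurable_cis_eigenphase) auto
  thus ?thesis by simp
qed

text \<open>The product of squared distances is the Vandermonde determinant times its conjugate;
  both are expanded by the Leibniz formula. Permutations act on \<open>{0..<N}\<close> since they
  serve as exponents, whereas eigenphases are numbered from 1, hence the shift
  \<open>i - 1\<close>.\<close>

lemma weyl_density_eq_sum_perms:
  "complex_of_real (weyl_density N \<theta>) = 1 / (fact N * (2 * pi) ^ N) *
     (\<Sum>\<sigma> | \<sigma> permutes {0..<N}. \<Sum>\<tau> | \<tau> permutes {0..<N}. signof \<sigma> * signof \<tau> *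
        (\<Prod>i=1..N. cis (of_int (int (\<sigma> (i - 1)) - int (\<tau> (i - 1))) * \<theta> i)))"
proof -
  define z where "z i = cis (\<theta> (Suc i))" for i
  have z_powers: "z i ^ s * cnj (z i) ^ t = cis (of_int (int s - int t) * \<theta> (Suc i))" for i s t
    by (simp add: z_def cis_cnj Complex.DeMoivre cis_mult ring_distribs)
  define D where "D = det (mat N N (\<lambda>(i, j). z i ^ j))"
  have D: "D = (\<Sum>\<sigma> | \<sigma> permutes {0..<N}. signof \<sigma> * (\<Prod>i<N. z i ^ \<sigma> i))"
  proof -
    have "\<sigma> permutes {0..<N} \<Longrightarrow> i < N \<Longrightarrow> \<sigma> i < N" for \<sigma> i
      using permutes_in_image[of \<sigma> "{0..<N}" i] by simp
    thus ?thesis unfolding D_def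
      by (subst det_def'[of _ N]) (auto intro!: sum.cong prod.cong arg_cong2[where f = "(*)"])
  qed
  \<comment> \<open>The reindexing also reverses each pair to match the order of factors in the
    Vandermonde formula, which the modulus does not notice.\<close>
  have "(\<Prod>(j, l) \<in> {(j, l). 1 \<le> j \<and> j < l \<and> l \<le> N}. (cmod (cis (\<theta> j) - cis (\<theta> l)))\<^sup>2)
      = (\<Prod>(i, m) \<in> (SIGMA i:{..<N}. {..<i}). (cmod (z i - z m))\<^sup>2)"
    by (rule prod.reindex_bij_witness[of _ "\<lambda>(i, m). (Suc m, Suc i)" "\<lambda>(j, l). (l - 1, j - 1)"])
       (auto simp: z_def norm_minus_commute)
  also have "\<dots> = (cmod D)\<^sup>2"
    unfolding D_def det_vandermonde
    by (simp add: prod.Sigma[symmetric] prod_norm[symmetric] prod_power_distrib)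
  moreover have "(complex_of_real (cmod D))\<^sup>2 = D * cnj D"
    by (metis complex_norm_square of_real_power)
  ultimately have "complex_of_real (weyl_density N \<theta>) = 1 / (fact N * (2 * pi) ^ N) * (D * cnj D)"
    by (simp add: weyl_density_def)
  also have "cnj D = (\<Sum>\<tau> | \<tau> permutes {0..<N}. signof \<tau> * (\<Prod>i<N. cnj (z i) ^ \<tau> i))"
    by (simp add: D)
  also have "D * \<dots> = (\<Sum>\<sigma> | \<sigma> permutes {0..<N}. \<Sum>\<tau> | \<tau> permutes {0..<N}.
      signof \<sigma> * signof \<tau> * (\<Prod>i<N. z i ^ \<sigma> i * cnj (z i) ^ \<tau> i))"
    unfolding D sum_product by (simp add: prod.distrib mult_ac)
  finally show ?thesis by (simp add: prod.atLeast1_atMost_eq z_powers)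
qed

text \<open>The eigenvalue \<open>m = n\<close> meets \<open>cis 0 = 1\<close> and contributes a
  factor independent of \<theta>; every other eigenvalue enters only through its ratio to the
  \<open>n\<close>-th.\<close>

lemma prod_char_poly_Z_eq:
  assumes "n \<in> {1..N}"
  shows "(\<Prod>r = 1..k. char_poly_Z N \<theta> (of_real (\<theta> n) + \<alpha> r))
    = (\<Prod>r = 1..k. 1 - exp (- \<i> * \<alpha> r)) *
      (\<Prod>m\<in>{1..N} - {n}. poly (\<Prod>r = 1..k. [:1, - exp (- \<i> * \<alpha> r):]) (cis (\<theta> m - \<theta> n)))"
proof -
  have "exp (\<i> * of_real (\<theta> m)) * exp (- \<i> * (of_real (\<theta> n) + \<alpha> r))
      = cis (\<theta> m - \<theta> n) * exp (- \<i> * \<alpha> r)" for m r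
    by (simp add: cis_conv_exp algebra_simps flip: exp_add)
  hence "(\<Prod>r = 1..k. char_poly_Z N \<theta> (of_real (\<theta> n) + \<alpha> r))
      = (\<Prod>m = 1..N. \<Prod>r = 1..k. 1 - cis (\<theta> m - \<theta> n) * exp (- \<i> * \<alpha> r))"
    unfolding char_poly_Z_def by (subst prod.swap) simp
  also have "\<dots> = (\<Prod>r = 1..k. 1 - exp (- \<i> * \<alpha> r)) *
      (\<Prod>m\<in>{1..N} - {n}. \<Prod>r = 1..k. 1 - cis (\<theta> m - \<theta> n) * exp (- \<i> * \<alpha> r))"
    by (subst prod.remove[of _ n]) (use assms in auto)
  finally show ?thesis by (simp add: poly_prod)
qed

text \<open>The pinned integrals turn each pair of permutations into a product of Toeplitz entries
  of \<open>P\<close>. The signed sum of these products is a cofactor sum, and that is read off from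
  the reciprocal series \<open>G\<close>.\<close>

lemma expectation_trig_poly_pinned:
  fixes P :: "complex poly" and G :: "complex fps"
  assumes PG: "fps_of_poly P * G = 1" and P0: "coeff P 0 = 1"
  shows "expectation_U N (\<lambda>\<theta>. \<Sum>n = 1..N. \<Prod>m\<in>{1..N} - {n}. poly P (cis (\<theta> m - \<theta> n)))
      = (\<Sum>a<N. \<Sum>i\<le>a. fps_nth G i)"
proof -
  let ?S = "{\<sigma>. \<sigma> permutes {0..<N}}"
  let ?K = "1 / (fact N * (2 * of_real pi) ^ N) :: complex"
  let ?f = "\<lambda>\<theta> :: nat \<Rightarrow> real. \<Sum>n = 1..N. \<Prod>m\<in>{1..N} - {n}. poly P (cis (\<theta> m - \<theta> n))"
  define T where "T = mat N N (\<lambda>(i, j). if i \<le> j then fps_nth (fps_of_poly P) (j - i) else 0)"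
  define e where "e \<sigma> \<tau> i = int (\<sigma> (i - 1)) - int (\<tau> (i - 1))" for \<sigma> \<tau> :: "nat \<Rightarrow> nat" and i
  define c where "c n \<sigma> \<tau> = (\<Prod>m\<in>{1..N} - {n}. if e \<sigma> \<tau> m \<le> 0 then coeff P (nat (- e \<sigma> \<tau> m)) else 0)" for n \<sigma> \<tau>
  have "?f \<in> borel_measurable (eigenphase_space N)"
  proof -
    have "(\<lambda>\<theta>. poly P (cis (\<theta> m - \<theta> n))) \<in> borel_measurable (eigenphase_space N)"
      if "m \<in> {1..N}" "n \<in> {1..N}" for m n
      unfolding cis_divide[symmetric] poly_altdef
      by (intro borel_measurable_sum borel_measurable_times borel_measurable_const
          borel_measurable_power borel_measurable_divide measurable_cis_eigenphase that)
    thus ?thesis by (intro borel_measurable_sum borel_measurable_prod) auto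
  qed
  hence "expectation_U N ?f = (\<integral>\<theta>. weyl_density N \<theta> *\<^sub>R ?f \<theta> \<partial>eigenphase_space N)"
    unfolding expectation_U_def haar_eigenphases_def
    by (intro integral_density measurable_weyl_density) (auto simp: weyl_density_nonneg)
  also have "(\<lambda>\<theta>. weyl_density N \<theta> *\<^sub>R ?f \<theta>) = (\<lambda>\<theta>. ?K * (\<Sum>n = 1..N. \<Sum>\<sigma>\<in>?S. \<Sum>\<tau>\<in>?S. signof \<sigma> * signof \<tau> *
        ((\<Prod>i=1..N. cis (of_int (e \<sigma> \<tau> i) * \<theta> i)) * (\<Prod>m\<in>{1..N} - {n}. poly P (cis (\<theta> m - \<theta> n))))))"
  proof
    fix \<theta> :: "nat \<Rightarrow> real"
    let ?w = "\<lambda>\<sigma> \<tau>. signof \<sigma> * signof \<tau> * (\<Prod>i=1..N. cis (of_int (e \<sigma> \<tau> i) * \<theta> i))"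
    let ?b = "\<lambda>n. \<Prod>m\<in>{1..N} - {n}. poly P (cis (\<theta> m - \<theta> n))"
    have "(\<Sum>\<sigma>\<in>?S. \<Sum>\<tau>\<in>?S. ?w \<sigma> \<tau>) * ?f \<theta> = (\<Sum>n=1..N. \<Sum>\<sigma>\<in>?S. \<Sum>\<tau>\<in>?S. ?w \<sigma> \<tau> * ?b n)"
      by (subst sum_distrib_left) (simp only: sum_distrib_right)
    thus "weyl_density N \<theta> *\<^sub>R ?f \<theta> = ?K * (\<Sum>n = 1..N. \<Sum>\<sigma>\<in>?S. \<Sum>\<tau>\<in>?S. signof \<sigma> * signof \<tau> *
        ((\<Prod>i=1..N. cis (of_int (e \<sigma> \<tau> i) * \<theta> i)) * ?b n))"
      by (simp only: scaleR_conv_of_real weyl_density_eq_sum_perms e_def mult.assoc)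
         (simp add: mult.assoc)
  qed
  also have "integral\<^sup>L (eigenphase_space N) \<dots> = ?K * (\<Sum>n = 1..N. \<Sum>\<sigma>\<in>?S. \<Sum>\<tau>\<in>?S.
      signof \<sigma> * signof \<tau> * (of_real ((2 * pi) ^ card {1..N}) * c n \<sigma> \<tau>))"
  proof (rule has_bochner_integral_integral_eq, intro has_bochner_integral_mult_right has_bochner_integral_sum)
    fix n \<sigma> \<tau> assume "n \<in> {1..N}" and "\<sigma> \<in> ?S" and "\<tau> \<in> ?S"
    \<comment> \<open>Both permutations list the same numbers, so the exponents
      \<open>e \<sigma> \<tau>\<close> sum to zero, as the pinned integral demands.\<close>
    have shift: "(\<Sum>i = 1..N. int (\<rho> (i - 1))) = (\<Sum>i = 0..<N. int i)" if "\<rho> \<in> ?S" for \<rho>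
      using sum.permute[of \<rho> "{0..<N}" int] that
      by (simp add: sum.atLeast1_atMost_eq atLeast0LessThan o_def)
    have "(\<Sum>i = 1..N. e \<sigma> \<tau> i) = 0"
      using shift[OF \<open>\<sigma> \<in> ?S\<close>] shift[OF \<open>\<tau> \<in> ?S\<close>] by (simp add: e_def sum_subtractf)
    thus "has_bochner_integral (eigenphase_space N)
      (\<lambda>\<theta>. (\<Prod>i=1..N. cis (of_int (e \<sigma> \<tau> i) * \<theta> i)) * (\<Prod>m\<in>{1..N} - {n}. poly P (cis (\<theta> m - \<theta> n))))
      (of_real ((2 * pi) ^ card {1..N}) * c n \<sigma> \<tau>)"
      unfolding c_def using \<open>n \<in> {1..N}\<close> by (intro has_bochner_integral_trig_poly_pinned) auto
  qed
  \<comment> \<open>The powers of \<open>2 * pi\<close> cancel against the Weyl normalization;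
    \<open>fact N\<close> will cancel against the count of permutations.\<close>
  also have "\<dots> = 1 / fact N * (\<Sum>n = 1..N. \<Sum>\<sigma>\<in>?S. \<Sum>\<tau>\<in>?S. signof \<sigma> * signof \<tau> * c n \<sigma> \<tau>)"
    by (simp add: sum_distrib_left field_simps)
  also have "(\<Sum>n = 1..N. \<Sum>\<sigma>\<in>?S. \<Sum>\<tau>\<in>?S. signof \<sigma> * signof \<tau> * c n \<sigma> \<tau>)
      = (\<Sum>n<N. \<Sum>\<sigma>\<in>?S. \<Sum>\<tau>\<in>?S. signof \<sigma> * signof \<tau> * (\<Prod>m\<in>{..<N} - {n}. T $$ (\<sigma> m, \<tau> m)))"
  proof -
    \<comment> \<open>The condition \<open>e \<sigma> \<tau> (Suc m) \<le> 0\<close> says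
      \<open>\<sigma> m \<le> \<tau> m\<close>, which is the upper triangular support of
      \<open>T\<close>.\<close>
    have "c (Suc n) \<sigma> \<tau> = (\<Prod>m\<in>{..<N} - {n}. T $$ (\<sigma> m, \<tau> m))"
      if "\<sigma> \<in> ?S" "\<tau> \<in> ?S" for n \<sigma> \<tau>
    proof -
      have "\<rho> m < N" if "\<rho> \<in> ?S" "m < N" for \<rho> m
        using permutes_in_image[of \<rho> "{0..<N}" m] that by simp
      note lt = this[OF that(1)] this[OF that(2)]
      show ?thesis unfolding c_def
        by (rule prod.reindex_bij_witness[of _ Suc "\<lambda>m. m - 1"])
           (auto simp: e_def T_def lt nat_minus_as_int)
    qed
    thus ?thesis by (simp add: sum.atLeast1_atMost_eq)
  qed
  also have "\<dots> = fact N * (\<Sum>a<N. \<Sum>b<N. cofactor T a b)"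
    by (rule sum_signed_perm_pairs_omitting_one) (simp add: T_def)
  also have "(\<Sum>a<N. \<Sum>b<N. cofactor T a b) = (\<Sum>a<N. \<Sum>i\<le>a. fps_nth G i)"
    unfolding T_def by (rule sum_fps_toeplitz_cofactors[OF PG]) (simp add: P0)
  finally show ?thesis by simp
qed

section \<open>Assembling the two formulas\<close>

text \<open>A variable equal to 1 multiplies the generating function by the all-ones series, which
  replaces coefficients by partial sums; two such variables iterate this twice.\<close>

lemma complete_homogeneous_append_ones:
  fixes xs :: "'a :: comm_semiring_1 list"
  shows "complete_homogeneous n (xs @ [1, 1])
     = (\<Sum>a<Suc n. \<Sum>i\<le>a. fps_nth (\<Prod>x\<leftarrow>xs. Abs_fps (\<lambda>n. x ^ n)) i)"
proof -
  define G where "G = (\<Prod>x\<leftarrow>xs. Abs_fps (\<lambda>n. x ^ n))"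
  have "Abs_fps ((^) (1 :: 'a)) = Abs_fps (\<lambda>_. 1)" by (rule fps_ext) simp
  hence "complete_homogeneous n (xs @ [1, 1]) = fps_nth (G * Abs_fps (\<lambda>n. 1) * Abs_fps (\<lambda>n. 1)) n"
    by (simp add: fps_nth_prod_geometric[symmetric] G_def mult.assoc)
  thus ?thesis
    by (simp add: fps_mult_nth[of _ "Abs_fps (\<lambda>n. 1)"] atLeast0AtMost G_def lessThan_Suc_atMost)
qed

lemma complete_homogeneous_map_append_ones:
  fixes x :: "nat \<Rightarrow> 'a :: comm_semiring_1"
  assumes "N \<ge> 1"
  shows "complete_homogeneous (N - 1) (map x [1..<k + 1] @ [1, 1])
     = (\<Sum>a<N. \<Sum>i\<le>a. fps_nth (\<Prod>r = 1..k. Abs_fps (\<lambda>n. x r ^ n)) i)"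
proof -
  have "(\<Prod>y\<leftarrow>map x [1..<k + 1]. Abs_fps (\<lambda>n. y ^ n)) = (\<Prod>r = 1..k. Abs_fps (\<lambda>n. x r ^ n))"
    by (simp add: prod.distinct_set_conv_list[symmetric] o_def) (auto intro!: prod.cong)
  thus ?thesis
    using assms unfolding complete_homogeneous_append_ones by simp
qed

text \<open>Specialization to exponentials: they never vanish, \<open>k \<ge> 1\<close> makes the
  index set nonempty, and the power \<open>N + k\<close> moves into the exponent.\<close>

lemma prod_times_sum_prod_geometric_coeffs_exp:
  fixes \<alpha> :: "nat \<Rightarrow> complex"
  defines "x \<equiv> (\<lambda>r. exp (- \<i> * \<alpha> r))"
  assumes "k \<ge> 1" and "inj_on x {1..k}" and "\<forall>r\<in>{1..k}. x r \<noteq> 1"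
  shows "(\<Prod>r = 1..k. 1 - x r) * (\<Sum>a<N. \<Sum>i\<le>a. fps_nth (\<Prod>r = 1..k. Abs_fps (\<lambda>n. x r ^ n)) i)
      = (\<Sum>r = 1..k. exp (- \<i> * of_nat (N + k) * \<alpha> r) / (1 - x r) *
          (\<Prod>j \<in> {1..k} - {r}. (1 - x j) / (x r - x j)))
        + of_nat N + of_nat k - (\<Sum>l = 1..k. 1 / (1 - x l))"
proof -
  have x_nz: "x r \<noteq> 0" for r by (simp add: x_def)
  have "x r ^ (N + k) = exp (- \<i> * of_nat (N + k) * \<alpha> r)" for r
    unfolding x_def exp_of_nat_mult[symmetric] by (simp add: algebra_simps)
  thus ?thesis
    using prod_times_sum_prod_geometric_coeffs[of "{1..k}" x N] assms(2-) by (simp add: x_nz)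
qed

text \<open>The common source of both formulas: the constant factor, which is the polynomial
  \<open>P\<close> at 1, leaves the expectation, and the product of geometric series is the
  reciprocal of \<open>P\<close>.\<close>

lemma expectation_mean_prod_char_poly_Z:
  "expectation_U N (\<lambda>\<theta>. 1 / of_nat N *
      (\<Sum>n = 1..N. \<Prod>r = 1..k. char_poly_Z N \<theta> (of_real (\<theta> n) + \<alpha> r)))
    = 1 / of_nat N * ((\<Prod>r = 1..k. 1 - exp (- \<i> * \<alpha> r)) *
        (\<Sum>a<N. \<Sum>i\<le>a. fps_nth (\<Prod>r = 1..k. Abs_fps (\<lambda>n. exp (- \<i> * \<alpha> r) ^ n)) i))"
proof -
  define x where "x r = exp (- \<i> * \<alpha> r)" for r
  define P where "P = (\<Prod>r = 1..k. [:1, - x r:])"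
  define G where "G = (\<Prod>r = 1..k. Abs_fps (\<lambda>n. x r ^ n))"
  have geo: "fps_of_poly [:1, - x r:] * Abs_fps (\<lambda>n. x r ^ n) = 1" for r
    using fps_geometric_mult[of "x r"] by (simp add: fps_of_poly_linear' flip: fps_const_neg)
  have PG: "fps_of_poly P * G = 1"
    by (simp add: P_def G_def fps_of_poly_prod geo flip: prod.distrib)
  have P0: "coeff P 0 = 1"
    by (simp add: P_def poly_prod flip: poly_0_coeff_0)
  have "(\<Sum>n = 1..N. \<Prod>r = 1..k. char_poly_Z N \<theta> (of_real (\<theta> n) + \<alpha> r))
      = (\<Prod>r = 1..k. 1 - x r) * (\<Sum>n = 1..N. \<Prod>m\<in>{1..N} - {n}. poly P (cis (\<theta> m - \<theta> n)))" for \<theta>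
    unfolding sum_distrib_left x_def P_def by (intro sum.cong refl prod_char_poly_Z_eq)
  thus ?thesis
    using expectation_trig_poly_pinned[OF PG P0, of N]
    by (simp add: expectation_U_def G_def x_def)
qed

theorem theorem3:
  fixes N k :: nat and \<alpha> :: "nat \<Rightarrow> complex"
  assumes "N \<ge> 1" and "k \<ge> 1"
  shows
    "expectation_U N (\<lambda>\<theta>. 1 / of_nat N *
        (\<Sum>n = 1..N. \<Prod>r = 1..k. char_poly_Z N \<theta> (of_real (\<theta> n) + \<alpha> r)))
     = 1 / of_nat N * (\<Prod>r = 1..k. 1 - exp (- \<i> * \<alpha> r)) *
         complete_homogeneous (N - 1) (map (\<lambda>r. exp (- \<i> * \<alpha> r)) [1..<k + 1] @ [1, 1])
     \<and>
     (inj_on (\<lambda>r. exp (- \<i> * \<alpha> r)) {1..k} \<and> (\<forall>r \<in> {1..k}. exp (- \<i> * \<alpha> r) \<noteq> 1) \<longrightarrow>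
      expectation_U N (\<lambda>\<theta>. 1 / of_nat N *
        (\<Sum>n = 1..N. \<Prod>r = 1..k. char_poly_Z N \<theta> (of_real (\<theta> n) + \<alpha> r)))
      = 1 / of_nat N *
          ((\<Sum>r = 1..k. exp (- \<i> * of_nat (N + k) * \<alpha> r) / (1 - exp (- \<i> * \<alpha> r)) *
              (\<Prod>j \<in> {1..k} - {r}.
                 (1 - exp (- \<i> * \<alpha> j)) / (exp (- \<i> * \<alpha> r) - exp (- \<i> * \<alpha> j))))
           + of_nat N + of_nat k - (\<Sum>l = 1..k. 1 / (1 - exp (- \<i> * \<alpha> l)))))"
  \<comment> \<open>Both claims become statements about the same double sum of coefficients. The
    first is then only a reassociation of factors; the second is the closed form for distinct
    exponentials.\<close>
  unfolding expectation_mean_prod_char_poly_Z complete_homogeneous_map_append_ones[OF assms(1)]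
  by (intro conjI impI)
     (simp only: mult.assoc, elim conjE, simp only: prod_times_sum_prod_geometric_coeffs_exp[OF assms(2)])

end
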